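(* The functor $B$ from the category of binary partial groups to the category of Chermak partial groups is fully faithful.
   Context: **Notation.** For expressions $a,b$ which may or may not be defined, $a \asymp b$ means that either both are undefined, or both are defined and $a=b$. **Binary partial groups.** A unital partial magma is a set $P$ with a partially defined binary operation $P\times P \nrightarrow P$, written $(a,b)\mapsto ab$, and an element $1\in P$ such that $a1\asymp a\asymp 1a$ for all $a\in P$. A binary partial group is a unital partial magma $P$ such that for each $a\in P$ there exists $a^\dagger\in P$ satisfying both of the following for all $b\in P$: (1) if $ab$ is defined then $a^\dagger(ab)\asymp b$; (2) if $ba$ is defined then $(ba)a^\dagger\asymp b$. The element $a^\dagger$ is unique. A map of binary partial groups $f\colon P\to Q$ is a (total) function such that whenever $ab$ is defined in $P$, the product $f(a)f(b)$ is defined in $Q$ and $f(ab)=f(a)f(b)$. (Such a map automatically preserves units and inverses.) **Chermak partial groups.** Let $\Upsilon$ be the category with objects $[n]=\{0,1,\dots,n\}$, $n\ge 0$, and morphisms all functions. A symmetric set is a functor $X\colon \Upsilon^{\mathrm{op}}\to \mathsf{Set}$; restricting along $\Delta^{\mathrm{op}}\to\Upsilon^{\mathrm{op}}$ gives its underlying simplicial set. The Segal map $\mathscr{E}_n\colon X_n\to X_1^{\times n}$ of a simplicial set has $i$-th component ($1\le i\le n$) induced by $[1]\to[n]$, $0\mapsto i-1$, $1\mapsto i$. A simplicial set is edgy if $\mathscr{E}_n$ is injective for all $n\ge 2$; a symmetric set is spiny if its underlying simplicial set is edgy; a simplicial or symmetric set $X$ is reduced if $X_0$ is a one-point set. A (Chermak)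 partial group is a reduced spiny symmetric set; partial groups form a full subcategory of symmetric sets. It is known that the forgetful functor from spiny symmetric sets to simplicial sets is fully faithful, and that an edgy simplicial set $X$ is in its essential image if and only if there is a simplicial map $\dagger\colon X^{\mathrm{op}}\to X$ such that (i) $\dagger\dagger^{\mathrm{op}}=\mathrm{id}_X$, and (ii) if $x\in X_n$ has $\mathscr{E}_n(x)=(a_1,\dots,a_n)$, then there is $y\in X_{2n}$ with $\mathscr{E}_{2n}(y)=(a_n^\dagger,\dots,a_1^\dagger,a_1,\dots,a_n)$ whose total product (the edge of $y$ from vertex $0$ to vertex $2n$) is a degenerate 1-simplex. Thus partial groups are identified with the reduced edgy simplicial sets admitting such a $\dagger$, with morphisms all simplicial maps. **The functor $B$.** For a binary partial group $P$, let $BP_n\subseteq P^{\times n}$ be the set of words $w$ of length $n$ such that every full parenthesization of $w$ gives a valid iterated multiplication in $P$ and all of these multiplications have the same value. So $BP_0=\ast$ (the empty word), $BP_1=P$, and $BP_2$ is the set of multipliable pairs. These sets form a simplicial set $BP$: inner face maps multiply two adjacent entries, outer face maps discard the first or last entry, and degeneracy maps insert the unit $1$. It is a Chermak partial group. A map $f\colon P\to Q$ of binary partial groups induces $Bf\colon BP\to BQ$ by applying $f$ entrywise. *)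

theory Defs
  imports "HOL-Library.FuncSet"
begin

section \<open>Binary partial groups\<close>

text \<open>An undefined product is \<^term>\<open>None\<close>, so that equality of options is the relation ``both sides are
  undefined, or both are defined and equal''.\<close>

record 'a partial_magma =
  carrier :: "'a set"
  pmult :: "'a \<Rightarrow> 'a \<Rightarrow> 'a option"
  unit :: 'a

definition unital_partial_magma :: "('a, 'z) partial_magma_scheme \<Rightarrow> bool" where
  "unital_partial_magma P \<longleftrightarrow>
     unit P \<in> carrier P \<and>
     (\<forall>a\<in>carrier P. \<forall>b\<in>carrier P. \<forall>c. pmult P a b = Some c \<longrightarrow> c \<in> carrier P) \<and>
     (\<forall>a\<in>carrier P. pmult P a (unit P) = Some a \<and> pmult P (unit P) a = Some a)"

definition is_inverse :: "('a, 'z) partial_magma_scheme \<Rightarrow> 'a \<Rightarrow> 'a \<Rightarrow> bool" where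
  "is_inverse P a a' \<longleftrightarrow> a' \<in> carrier P \<and>
     (\<forall>b\<in>carrier P.
        (\<forall>c. pmult P a b = Some c \<longrightarrow> pmult P a' c = Some b) \<and>
        (\<forall>c. pmult P b a = Some c \<longrightarrow> pmult P c a' = Some b))"

definition binary_partial_group :: "('a, 'z) partial_magma_scheme \<Rightarrow> bool" where
  "binary_partial_group P \<longleftrightarrow>
     unital_partial_magma P \<and> (\<forall>a\<in>carrier P. \<exists>a'. is_inverse P a a')"

definition dagger :: "('a, 'z) partial_magma_scheme \<Rightarrow> 'a \<Rightarrow> 'a" where
  "dagger P a = (THE a'. is_inverse P a a')"

lemma is_inverse_unique:
  assumes P: "unital_partial_magma P" and a: "a \<in> carrier P"
    and x: "is_inverse P a x" and y: "is_inverse P a y"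
  shows "x = y"
proof -
  have "pmult P y a = Some (unit P)"
    using P a y unfolding unital_partial_magma_def is_inverse_def by blast
  then have "pmult P (unit P) x = Some y"
    using x y unfolding is_inverse_def by blast
  moreover have "pmult P (unit P) x = Some x"
    using P x unfolding unital_partial_magma_def is_inverse_def by blast
  ultimately show ?thesis by simp
qed

lemma is_inverse_dagger:
  assumes "binary_partial_group P" and "a \<in> carrier P"
  shows "is_inverse P a (dagger P a)"
proof -
  have P: "unital_partial_magma P" and ex: "\<exists>a'. is_inverse P a a'"
    using assms by (simp_all add: binary_partial_group_def)
  have "\<exists>!a'. is_inverse P a a'"
    using ex is_inverse_unique[OF P assms(2)] by (rule ex_ex1I)
  then show ?thesis unfolding dagger_def by (rule theI')
qed

text \<open>Functions that serve as morphisms are extensional, so that they are determined by their values on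
  the carrier and hom-sets can be compared by bijections.\<close>

definition bpg_hom ::
    "('a, 'y) partial_magma_scheme \<Rightarrow> ('b, 'z) partial_magma_scheme \<Rightarrow> ('a \<Rightarrow> 'b) set" where
  "bpg_hom P Q = {f \<in> carrier P \<rightarrow>\<^sub>E carrier Q.
     \<forall>a\<in>carrier P. \<forall>b\<in>carrier P. \<forall>c. pmult P a b = Some c \<longrightarrow> pmult Q (f a) (f b) = Some (f c)}"

section \<open>Symmetric sets and Chermak partial groups\<close>

text \<open>The maps from \<open>[m] = {0,\<dots>,m}\<close> to \<open>[n] = {0,\<dots>,n}\<close>.\<close>

definition ordmaps :: "nat \<Rightarrow> nat \<Rightarrow> (nat \<Rightarrow> nat) set" where
  "ordmaps m n = {..m} \<rightarrow>\<^sub>E {..n}"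

text \<open>\<open>act X m n \<alpha>\<close> is the operator from the \<open>n\<close>-simplices to the \<open>m\<close>-simplices induced by \<open>\<alpha>\<close> in
  \<^term>\<open>ordmaps m n\<close>. Its values on other arguments are irrelevant.\<close>

record 'x symset =
  simplices :: "nat \<Rightarrow> 'x set"
  act :: "nat \<Rightarrow> nat \<Rightarrow> (nat \<Rightarrow> nat) \<Rightarrow> 'x \<Rightarrow> 'x"

definition symmetric_set :: "('x, 'z) symset_scheme \<Rightarrow> bool" where
  "symmetric_set X \<longleftrightarrow>
     (\<forall>m n. \<forall>\<alpha>\<in>ordmaps m n. act X m n \<alpha> \<in> simplices X n \<rightarrow> simplices X m) \<and>
     (\<forall>n. \<forall>x\<in>simplices X n. act X n n (restrict id {..n}) x = x) \<and>
     (\<forall>l m n. \<forall>\<alpha>\<in>ordmaps l m. \<forall>\<beta>\<in>ordmaps m n. \<forall>x\<in>simplices X n.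
        act X l n (compose {..l} \<beta> \<alpha>) x = act X l m \<alpha> (act X m n \<beta> x))"

definition edge_map :: "nat \<Rightarrow> nat \<Rightarrow> nat \<Rightarrow> nat" where
  "edge_map i j = (\<lambda>k\<in>{..1}. if k = 0 then i else j)"

definition segal :: "('x, 'z) symset_scheme \<Rightarrow> nat \<Rightarrow> 'x \<Rightarrow> 'x list" where
  "segal X n x = map (\<lambda>i. act X 1 n (edge_map (i - 1) i) x) [1..<Suc n]"

text \<open>The Segal maps involve only order-preserving maps, so they are those of the underlying simplicial
  set.\<close>

definition spiny :: "('x, 'z) symset_scheme \<Rightarrow> bool" where
  "spiny X \<longleftrightarrow> (\<forall>n\<ge>2. inj_on (segal X n) (simplices X n))"

definition reduced :: "('x, 'z) symset_scheme \<Rightarrow> bool" where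
  "reduced X \<longleftrightarrow> is_singleton (simplices X 0)"

definition chermak_partial_group :: "('x, 'z) symset_scheme \<Rightarrow> bool" where
  "chermak_partial_group X \<longleftrightarrow> symmetric_set X \<and> spiny X \<and> reduced X"

definition symset_hom ::
    "('x, 'w) symset_scheme \<Rightarrow> ('y, 'z) symset_scheme \<Rightarrow> (nat \<Rightarrow> 'x \<Rightarrow> 'y) set" where
  "symset_hom X Y = {\<phi>.
     (\<forall>n. \<phi> n \<in> simplices X n \<rightarrow>\<^sub>E simplices Y n) \<and>
     (\<forall>m n. \<forall>\<alpha>\<in>ordmaps m n. \<forall>x\<in>simplices X n. \<phi> m (act X m n \<alpha> x) = act Y m n \<alpha> (\<phi> n x))}"

definition symset_id :: "('x, 'z) symset_scheme \<Rightarrow> nat \<Rightarrow> 'x \<Rightarrow> 'x" where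
  "symset_id X n = restrict id (simplices X n)"

definition symset_comp ::
    "('x, 'z) symset_scheme \<Rightarrow> (nat \<Rightarrow> 'y \<Rightarrow> 'v) \<Rightarrow> (nat \<Rightarrow> 'x \<Rightarrow> 'y) \<Rightarrow> nat \<Rightarrow> 'x \<Rightarrow> 'v" where
  "symset_comp X \<psi> \<phi> n = compose (simplices X n) (\<psi> n) (\<phi> n)"

section \<open>The functor \<open>B\<close>\<close>

datatype 'a paren = Letter 'a | Times "'a paren" "'a paren"

primrec word :: "'a paren \<Rightarrow> 'a list" where
  "word (Letter a) = [a]"
| "word (Times s t) = word s @ word t"

primrec evaluate :: "('a, 'z) partial_magma_scheme \<Rightarrow> 'a paren \<Rightarrow> 'a option" where
  "evaluate P (Letter a) = Some a"
| "evaluate P (Times s t) =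
     Option.bind (evaluate P s) (\<lambda>x. Option.bind (evaluate P t) (\<lambda>y. pmult P x y))"

text \<open>No parenthesization has the empty word, which therefore belongs to \<^term>\<open>B_words P 0\<close>.\<close>

definition B_words :: "('a, 'z) partial_magma_scheme \<Rightarrow> nat \<Rightarrow> 'a list set" where
  "B_words P n = {w. length w = n \<and> set w \<subseteq> carrier P \<and>
     (\<exists>c. \<forall>t. word t = w \<longrightarrow> evaluate P t = Some c)}"

definition word_prod :: "('a, 'z) partial_magma_scheme \<Rightarrow> 'a list \<Rightarrow> 'a" where
  "word_prod P w =
     (if w = [] then unit P else (THE c. \<forall>t. word t = w \<longrightarrow> evaluate P t = Some c))"

text \<open>The edge of a word from vertex \<open>i\<close> to vertex \<open>j\<close> is the product of the letters between the two
  vertices, inverted if the edge runs backwards.\<close>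

definition word_edge :: "('a, 'z) partial_magma_scheme \<Rightarrow> 'a list \<Rightarrow> nat \<Rightarrow> nat \<Rightarrow> 'a" where
  "word_edge P w i j =
     (if i \<le> j then word_prod P (take (j - i) (drop i w))
      else dagger P (word_prod P (take (i - j) (drop j w))))"

text \<open>A simplex of a spiny symmetric set is determined by its edges, so the operator of \<open>\<alpha>\<close> has to send a
  word to the word of its edges from vertex \<open>\<alpha> i\<close> to vertex \<open>\<alpha> (i + 1)\<close>. The lemmas \<open>B_obj_face\<close> and
  \<open>B_obj_degeneracy\<close> below show that the underlying simplicial set has the usual face and degeneracy
  maps on words; a simplicial set has at most one spiny symmetric structure.\<close>

definition B_obj :: "('a, 'z) partial_magma_scheme \<Rightarrow> 'a list symset" where
  "B_obj P = \<lparr>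
     simplices = B_words P,
     act = (\<lambda>m n \<alpha> w. map (\<lambda>i. word_edge P w (\<alpha> i) (\<alpha> (Suc i))) [0..<m])\<rparr>"

definition B_map :: "('a, 'z) partial_magma_scheme \<Rightarrow> ('a \<Rightarrow> 'b) \<Rightarrow> nat \<Rightarrow> 'a list \<Rightarrow> 'b list" where
  "B_map P f n = restrict (map f) (B_words P n)"

section \<open>Faces and degeneracies of words\<close>

definition coface :: "nat \<Rightarrow> nat \<Rightarrow> nat \<Rightarrow> nat" where
  "coface n i = (\<lambda>k\<in>{..n}. if k < i then k else Suc k)"

definition codegeneracy :: "nat \<Rightarrow> nat \<Rightarrow> nat \<Rightarrow> nat" where
  "codegeneracy n i = (\<lambda>k\<in>{..Suc n}. if k \<le> i then k else k - 1)"

definition word_face :: "('a, 'z) partial_magma_scheme \<Rightarrow> nat \<Rightarrow> 'a list \<Rightarrow> 'a list" where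
  "word_face P i w =
     (if i = 0 then tl w
      else if i = length w then butlast w
      else take (i - 1) w @ the (pmult P (w ! (i - 1)) (w ! i)) # drop (Suc i) w)"

definition word_degeneracy :: "('a, 'z) partial_magma_scheme \<Rightarrow> nat \<Rightarrow> 'a list \<Rightarrow> 'a list" where
  "word_degeneracy P i w = take i w @ unit P # drop i w"

lemma word_nonempty [simp]: "word t \<noteq> []"
  by (induction t) auto

lemma word_singleton_iff [simp]: "word t = [a] \<longleftrightarrow> t = Letter a"
  by (cases t) (auto simp: append_eq_Cons_conv)

lemma word_pair_iff: "word t = [a, b] \<longleftrightarrow> t = Times (Letter a) (Letter b)"
  by (cases t) (auto simp: append_eq_Cons_conv)

lemma word_prod_Nil [simp]: "word_prod P [] = unit P"
  by (simp add: word_prod_def)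

lemma word_prod_singleton [simp]: "word_prod P [a] = a"
  by (simp add: word_prod_def)

lemma word_prod_pair:
  assumes "pmult P a b = Some c"
  shows "word_prod P [a, b] = c"
  using assms by (simp add: word_prod_def word_pair_iff)

lemma exists_paren:
  assumes "ts \<noteq> []"
  shows "\<exists>t. word t = concat (map word ts) \<and> (evaluate P t \<noteq> None \<longrightarrow> (\<forall>s\<in>set ts. evaluate P s \<noteq> None))"
  using assms
proof (induction ts rule: list_nonempty_induct)
  case (single s)
  then show ?case by (intro exI[of _ s]) simp
next
  case (cons s ts)
  then obtain t where "word t = concat (map word ts)"
    "evaluate P t \<noteq> None \<longrightarrow> (\<forall>s\<in>set ts. evaluate P s \<noteq> None)" by blast
  then show ?case
    by (intro exI[of _ "Times s t"]) (auto simp: bind_eq_Some_conv)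
qed

lemma B_words_adjacent:
  assumes "u @ a # b # v \<in> B_words P n"
  shows "\<exists>c. pmult P a b = Some c"
proof -
  let ?ts = "map Letter u @ Times (Letter a) (Letter b) # map Letter v"
  have *: "concat (map word (map Letter u)) = u" for u :: "'a list"
    by (induction u) auto
  obtain t where t: "word t = concat (map word ?ts)"
    "evaluate P t \<noteq> None \<longrightarrow> (\<forall>s\<in>set ?ts. evaluate P s \<noteq> None)"
    using exists_paren[of ?ts P] by blast
  have "word t = u @ a # b # v"
    using t(1) * by (simp del: map_map)
  with assms have "evaluate P t \<noteq> None"
    by (auto simp: B_words_def)
  with t(2) have "evaluate P (Times (Letter a) (Letter b)) \<noteq> None" by simp
  then show ?thesis by simp
qed

lemma word_edge_same [simp]: "word_edge P w i i = unit P"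
  by (simp add: word_edge_def)

lemma word_edge_Suc: "i < length w \<Longrightarrow> word_edge P w i (Suc i) = w ! i"
  by (simp add: word_edge_def take_Suc hd_drop_conv_nth)

lemma word_edge_Suc_Suc:
  assumes "w \<in> B_words P n" and "Suc i < n"
  shows "word_edge P w i (Suc (Suc i)) = the (pmult P (w ! i) (w ! Suc i))"
proof -
  have len: "length w = n" using assms(1) by (simp add: B_words_def)
  have dr: "drop i w = w ! i # w ! Suc i # drop (Suc (Suc i)) w"
    using assms(2) len by (simp add: Cons_nth_drop_Suc)
  then have "take i w @ w ! i # w ! Suc i # drop (Suc (Suc i)) w \<in> B_words P n"
    using assms(1) by (metis append_take_drop_id)
  then obtain c where c: "pmult P (w ! i) (w ! Suc i) = Some c"
    using B_words_adjacent[of "take i w"] by blast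
  have "word_edge P w i (Suc (Suc i)) = word_prod P (take 2 (drop i w))"
    by (simp add: word_edge_def numeral_2_eq_2)
  also have "\<dots> = word_prod P [w ! i, w ! Suc i]"
    by (subst dr) (simp add: numeral_2_eq_2)
  finally show ?thesis using c by (simp add: word_prod_pair)
qed

lemma B_obj_face:
  assumes w: "w \<in> simplices (B_obj P) (Suc n)" and i: "i \<le> Suc n"
  shows "act (B_obj P) n (Suc n) (coface n i) w = word_face P i w"
proof (rule nth_equalityI)
  have w': "w \<in> B_words P (Suc n)" and len: "length w = Suc n"
    using w by (auto simp: B_obj_def B_words_def)
  show "length (act (B_obj P) n (Suc n) (coface n i) w) = length (word_face P i w)"
    using i len by (auto simp: B_obj_def word_face_def)
  fix k assume "k < length (act (B_obj P) n (Suc n) (coface n i) w)"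
  then have k: "k < n" by (simp add: B_obj_def)
  have *: "act (B_obj P) n (Suc n) (coface n i) w ! k =
      word_edge P w (if k < i then k else Suc k) (if Suc k < i then Suc k else Suc (Suc k))"
    using k by (simp add: B_obj_def coface_def)
  consider "Suc k < i" | "Suc k = i" | "i \<le> k" by linarith
  then show "act (B_obj P) n (Suc n) (coface n i) w ! k = word_face P i w ! k"
  proof cases
    case 1
    then show ?thesis unfolding * using k i len
      by (auto simp: word_edge_Suc word_face_def nth_append nth_butlast)
  next
    case 2
    then show ?thesis unfolding * using k i len word_edge_Suc_Suc[OF w', of k]
      by (auto simp: word_face_def nth_append)
  next
    case 3
    then show ?thesis unfolding * using k i len
      by (auto simp: word_edge_Suc word_face_def nth_append nth_tl nth_Cons')
  qed
qed

lemma B_obj_degeneracy: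
  assumes w: "w \<in> simplices (B_obj P) n" and i: "i \<le> n"
  shows "act (B_obj P) (Suc n) n (codegeneracy n i) w = word_degeneracy P i w"
proof (rule nth_equalityI)
  have len: "length w = n"
    using w by (auto simp: B_obj_def B_words_def)
  show "length (act (B_obj P) (Suc n) n (codegeneracy n i) w) = length (word_degeneracy P i w)"
    using i len by (auto simp: B_obj_def word_degeneracy_def)
  fix k assume "k < length (act (B_obj P) (Suc n) n (codegeneracy n i) w)"
  then have k: "k < Suc n" by (simp add: B_obj_def)
  have *: "act (B_obj P) (Suc n) n (codegeneracy n i) w ! k =
      word_edge P w (if k \<le> i then k else k - 1) (if Suc k \<le> i then Suc k else k)"
    using k by (simp add: B_obj_def codegeneracy_def del: upt_Suc)
  consider "k < i" | "k = i" | "i < k" by linarith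
  then show "act (B_obj P) (Suc n) n (codegeneracy n i) w ! k = word_degeneracy P i w ! k"
  proof cases
    case 1
    then show ?thesis unfolding * using k i len
      by (auto simp: word_edge_Suc word_degeneracy_def nth_append)
  next
    case 2
    then show ?thesis unfolding * using k i len
      by (auto simp: word_degeneracy_def nth_append)
  next
    case 3
    then obtain j where "k = Suc j" by (cases k) auto
    with 3 show ?thesis unfolding * using k i len
      by (auto simp: word_edge_Suc word_degeneracy_def nth_append nth_Cons' Suc_diff_le)
  qed
qed

end

theory Submission
  imports Defs
begin

text \<open>
  A word \<open>w\<close> of length \<open>n\<close> in \<open>BP\<close> is the same thing as a labelling \<open>E\<close> of the ordered pairs of
  elements of \<open>[n]\<close> by elements of \<open>P\<close> such that \<open>E i j\<close> and \<open>E j k\<close> always multiply to \<open>E i k\<close>, for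
  \<open>i, j, k\<close> in any order; in other words, a map from the indiscrete groupoid on \<open>[n]\<close> to \<open>P\<close>. Such a
  labelling is called a cocycle below.

  In one direction, the edges \<^term>\<open>word_edge P w\<close> form a cocycle (\<open>cocycle_word_edge\<close>): every factor
  of a word in \<open>BP\<close> is in \<open>BP\<close>, by cancellation, so the relation holds for \<open>i \<le> j \<le> k\<close>; and if
  \<open>ab = c\<close>, then also \<open>a\<^sup>\<dagger>c = b\<close>, \<open>cb\<^sup>\<dagger> = a\<close>, \<open>c\<^sup>\<dagger>a = b\<^sup>\<dagger>\<close>, \<open>bc\<^sup>\<dagger> = a\<^sup>\<dagger>\<close> and \<open>b\<^sup>\<dagger>a\<^sup>\<dagger> = c\<^sup>\<dagger>\<close>, which covers the other
  orders. In the other direction, the consecutive entries \<open>E i (i + 1)\<close> of a cocycle form a word,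
  because each of its parenthesizations evaluates to \<open>E 0 n\<close>, and the edges of this word give back \<open>E\<close>
  (\<open>spine_in_B_words\<close> and \<open>word_edge_spine\<close>).

  Cocycles can be pulled back along any map \<open>[m] \<rightarrow> [n]\<close> and pushed forward along any map of binary
  partial groups. The first makes \<open>BP\<close> a symmetric set, and the second makes \<open>B\<close> a functor. Since the
  Segal maps of \<open>BP\<close> are the inclusions of words into tuples, \<open>BP\<close> is spiny, and a map of symmetric sets
  \<open>\<phi>: BP \<rightarrow> BQ\<close> is determined by its effect \<open>f\<close> on \<open>BP\<^sub>1 = P\<close>. The value of \<open>\<phi>\<close> on a two-letter word
  shows that \<open>f\<close> preserves products, so \<open>\<phi> = Bf\<close>.
\<close>

section \<open>Inverses in a binary partial group\<close>

lemma pmult_closed: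
  assumes "binary_partial_group P" "a \<in> carrier P" "b \<in> carrier P" "pmult P a b = Some c"
  shows "c \<in> carrier P"
  using assms unfolding binary_partial_group_def unital_partial_magma_def by blast

lemma unit_closed: "binary_partial_group P \<Longrightarrow> unit P \<in> carrier P"
  by (simp add: binary_partial_group_def unital_partial_magma_def)

lemma pmult_unit:
  assumes "binary_partial_group P" "a \<in> carrier P"
  shows "pmult P a (unit P) = Some a" "pmult P (unit P) a = Some a"
  using assms by (simp_all add: binary_partial_group_def unital_partial_magma_def)

lemma dagger_closed:
  assumes "binary_partial_group P" "a \<in> carrier P"
  shows "dagger P a \<in> carrier P"
  using is_inverse_dagger[OF assms] by (simp add: is_inverse_def)

lemma dagger_pmult:
  assumes "binary_partial_group P" "a \<in> carrier P" "b \<in> carrier P" "pmult P a b = Some c"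
  shows "pmult P (dagger P a) c = Some b"
  using is_inverse_dagger[OF assms(1,2)] assms(3,4) by (simp add: is_inverse_def)

lemma pmult_dagger:
  assumes "binary_partial_group P" "a \<in> carrier P" "b \<in> carrier P" "pmult P a b = Some c"
  shows "pmult P c (dagger P b) = Some a"
  using is_inverse_dagger[OF assms(1,3)] assms(2,4) by (simp add: is_inverse_def)

lemma dagger_dagger:
  assumes P: "binary_partial_group P" and a: "a \<in> carrier P"
  shows "dagger P (dagger P a) = a"
proof -
  have "pmult P (dagger P a) a = Some (unit P)"
    using dagger_pmult[OF P a unit_closed[OF P]] pmult_unit[OF P a] by simp
  then have "pmult P (dagger P (dagger P a)) (unit P) = Some a"
    using dagger_pmult[OF P dagger_closed[OF P a] a] by simp
  then show ?thesis
    using pmult_unit[OF P dagger_closed[OF P dagger_closed[OF P a]]] by simp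
qed

lemma eq_dagger:
  assumes P: "binary_partial_group P" and a: "a \<in> carrier P" and b: "b \<in> carrier P"
    and "pmult P a b = Some (unit P)"
  shows "b = dagger P a"
  using dagger_pmult[OF assms] pmult_unit(1)[OF P dagger_closed[OF P a]] by simp

lemma dagger_unit:
  assumes P: "binary_partial_group P"
  shows "dagger P (unit P) = unit P"
  using eq_dagger[OF P unit_closed[OF P] unit_closed[OF P]] pmult_unit[OF P unit_closed[OF P]] by simp

lemma idempotent_unit:
  assumes P: "binary_partial_group P" and a: "a \<in> carrier P" and "pmult P a a = Some a"
  shows "a = unit P"
  using dagger_pmult[OF P a a assms(3)] dagger_pmult[OF P a unit_closed[OF P]] pmult_unit[OF P a]
  by simp

lemma pmult_rotations:
  assumes P: "binary_partial_group P" and a: "a \<in> carrier P" and b: "b \<in> carrier P"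
    and ab: "pmult P a b = Some c"
  shows "pmult P (dagger P c) a = Some (dagger P b)"
    and "pmult P b (dagger P c) = Some (dagger P a)"
    and "pmult P (dagger P b) (dagger P a) = Some (dagger P c)"
proof -
  have c: "c \<in> carrier P"
    using pmult_closed[OF P a b ab] .
  show 1: "pmult P (dagger P c) a = Some (dagger P b)"
    using dagger_pmult[OF P c dagger_closed[OF P b] pmult_dagger[OF P a b ab]] .
  show "pmult P b (dagger P c) = Some (dagger P a)"
    using pmult_dagger[OF P dagger_closed[OF P a] c dagger_pmult[OF P a b ab]] .
  show "pmult P (dagger P b) (dagger P a) = Some (dagger P c)"
    using pmult_dagger[OF P dagger_closed[OF P c] a 1] .
qed

section \<open>Factors of words\<close>

lemma exists_paren_word:
  assumes "w \<noteq> []"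
  shows "\<exists>t. word t = w"
  using assms
proof (induction w rule: list_nonempty_induct)
  case (single a)
  then show ?case by (intro exI[of _ "Letter a"]) simp
next
  case (cons a w)
  then obtain t where "word t = w" by blast
  then show ?case by (intro exI[of _ "Times (Letter a) t"]) simp
qed

lemma evaluate_closed:
  assumes "binary_partial_group P" "set (word t) \<subseteq> carrier P" "evaluate P t = Some c"
  shows "c \<in> carrier P"
  using assms(2,3)
proof (induction t arbitrary: c)
  case (Times s t)
  then obtain x y where "evaluate P s = Some x" "evaluate P t = Some y" and xy: "pmult P x y = Some c"
    by (auto simp: bind_eq_Some_conv)
  with Times have "x \<in> carrier P" "y \<in> carrier P"
    by simp_all
  then show ?case
    using pmult_closed[OF assms(1)] xy by blast
qed simp

lemma word_prod_eqI:
  assumes "w \<noteq> []" "\<And>t. word t = w \<Longrightarrow> evaluate P t = Some c"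
  shows "word_prod P w = c"
proof -
  obtain t where "word t = w"
    using exists_paren_word[OF assms(1)] by blast
  then have "(THE c. \<forall>t. word t = w \<longrightarrow> evaluate P t = Some c) = c"
    using assms(2) by (intro the_equality) auto
  then show ?thesis
    using assms(1) by (simp add: word_prod_def)
qed

lemma B_words_value: "w \<in> B_words P n \<Longrightarrow> \<exists>c. \<forall>t. word t = w \<longrightarrow> evaluate P t = Some c"
  by (simp add: B_words_def)

lemma B_wordsI:
  assumes "set w \<subseteq> carrier P" "\<And>t. word t = w \<Longrightarrow> evaluate P t = Some c"
  shows "w \<in> B_words P (length w)"
  unfolding B_words_def using assms by blast

lemma evaluate_word_prod:
  assumes "word t \<in> B_words P n"
  shows "evaluate P t = Some (word_prod P (word t))"
proof -
  obtain c where c: "\<forall>s. word s = word t \<longrightarrow> evaluate P s = Some c"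
    using B_words_value[OF assms] ..
  then have "word_prod P (word t) = c"
    by (intro word_prod_eqI) simp_all
  with c show ?thesis by simp
qed

lemma B_words_length: "w \<in> B_words P n \<Longrightarrow> length w = n"
  by (simp add: B_words_def)

lemma B_words_carrier: "w \<in> B_words P n \<Longrightarrow> set w \<subseteq> carrier P"
  by (simp add: B_words_def)

lemma B_words_0: "B_words P 0 = {[]}"
  by (auto simp: B_words_def)

lemma singleton_in_B_words: "[a] \<in> B_words P 1 \<longleftrightarrow> a \<in> carrier P"
  by (auto simp: B_words_def)

lemma pair_in_B_words:
  "[a, b] \<in> B_words P 2 \<longleftrightarrow> a \<in> carrier P \<and> b \<in> carrier P \<and> (\<exists>c. pmult P a b = Some c)"
  by (auto simp: B_words_def word_pair_iff)

lemma word_prod_closed: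
  assumes P: "binary_partial_group P" and w: "w \<in> B_words P n"
  shows "word_prod P w \<in> carrier P"
proof (cases "w = []")
  case True
  then show ?thesis using unit_closed[OF P] by simp
next
  case False
  then obtain t where t: "word t = w"
    using exists_paren_word by blast
  have "evaluate P t = Some (word_prod P w)"
    using evaluate_word_prod[of t P n] w t by simp
  then show ?thesis
    using evaluate_closed[OF P, of t] B_words_carrier[OF w] t by simp
qed

text \<open>The parenthesizations of \<open>w\<close> all agree because a fixed letter can be cancelled from the value
  of the longer word.\<close>

lemma B_words_tl:
  assumes P: "binary_partial_group P" and w: "a # w \<in> B_words P n"
  shows "w \<in> B_words P (length w)"
proof -
  obtain c where c: "\<forall>t. word t = a # w \<longrightarrow> evaluate P t = Some c"
    using B_words_value[OF w] ..
  have car: "a \<in> carrier P" "set w \<subseteq> carrier P"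
    using B_words_carrier[OF w] by auto
  have "evaluate P t = Some (the (pmult P (dagger P a) c))" if t: "word t = w" for t
  proof -
    have "evaluate P (Times (Letter a) t) = Some c"
      using c t by (simp del: evaluate.simps)
    then obtain y where y: "evaluate P t = Some y" "pmult P a y = Some c"
      by (auto simp: bind_eq_Some_conv)
    have "y \<in> carrier P"
      using evaluate_closed[OF P _ y(1)] t car by simp
    then show ?thesis
      using dagger_pmult[OF P car(1) _ y(2)] y(1) by simp
  qed
  then show ?thesis
    by (rule B_wordsI[OF car(2)])
qed

lemma B_words_butlast:
  assumes P: "binary_partial_group P" and w: "w @ [a] \<in> B_words P n"
  shows "w \<in> B_words P (length w)"
proof -
  obtain c where c: "\<forall>t. word t = w @ [a] \<longrightarrow> evaluate P t = Some c"
    using B_words_value[OF w] ..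
  have car: "a \<in> carrier P" "set w \<subseteq> carrier P"
    using B_words_carrier[OF w] by auto
  have "evaluate P t = Some (the (pmult P c (dagger P a)))" if t: "word t = w" for t
  proof -
    have "evaluate P (Times t (Letter a)) = Some c"
      using c t by (simp del: evaluate.simps)
    then obtain y where y: "evaluate P t = Some y" "pmult P y a = Some c"
      by (auto simp: bind_eq_Some_conv)
    have "y \<in> carrier P"
      using evaluate_closed[OF P _ y(1)] t car by simp
    then show ?thesis
      using pmult_dagger[OF P _ car(1) y(2)] y(1) by simp
  qed
  then show ?thesis
    by (rule B_wordsI[OF car(2)])
qed

lemma B_words_suffix:
  assumes P: "binary_partial_group P"
  shows "u @ v \<in> B_words P n \<Longrightarrow> v \<in> B_words P (length v)"
proof (induction u arbitrary: n)
  case Nil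
  then show ?case using B_words_length[of v P n] by simp
next
  case (Cons a u)
  then show ?case using B_words_tl[OF P, of a "u @ v" n] by simp
qed

lemma B_words_prefix:
  assumes P: "binary_partial_group P"
  shows "u @ v \<in> B_words P n \<Longrightarrow> u \<in> B_words P (length u)"
proof (induction v arbitrary: n rule: rev_induct)
  case Nil
  then show ?case using B_words_length[of u P n] by simp
next
  case (snoc a v)
  then show ?case using B_words_butlast[OF P, of "u @ v" a n] by simp
qed

lemma B_words_factor:
  assumes "binary_partial_group P" "w \<in> B_words P n"
  shows "take k (drop i w) \<in> B_words P (length (take k (drop i w)))"
proof -
  have "take i w @ drop i w \<in> B_words P n"
    using assms(2) by simp
  then have "take k (drop i w) @ drop k (drop i w) \<in> B_words P (length (drop i w))"
    using B_words_suffix[OF assms(1), of "take i w" "drop i w" n] by (simp del: drop_drop length_drop)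
  then show ?thesis
    by (rule B_words_prefix[OF assms(1)])
qed

lemma word_prod_append:
  assumes P: "binary_partial_group P" and uv: "u @ v \<in> B_words P n"
  shows "pmult P (word_prod P u) (word_prod P v) = Some (word_prod P (u @ v))"
proof -
  have u: "u \<in> B_words P (length u)" and v: "v \<in> B_words P (length v)"
    using B_words_prefix[OF P uv] B_words_suffix[OF P uv] .
  show ?thesis
  proof (cases "u = [] \<or> v = []")
    case True
    then show ?thesis
      using pmult_unit[OF P word_prod_closed[OF P u]] pmult_unit[OF P word_prod_closed[OF P v]] by auto
  next
    case False
    then have "u \<noteq> []" "v \<noteq> []" by simp_all
    then obtain s t where st: "word s = u" "word t = v"
      using exists_paren_word[of u] exists_paren_word[of v] by blast
    have "evaluate P (Times s t) = Some (word_prod P (u @ v))"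
      using evaluate_word_prod[of "Times s t" P n] uv st by simp
    moreover have "evaluate P s = Some (word_prod P u)" "evaluate P t = Some (word_prod P v)"
      using evaluate_word_prod[of s P "length u"] evaluate_word_prod[of t P "length v"] u v st
      by simp_all
    ultimately show ?thesis by simp
  qed
qed

section \<open>Words and cocycles\<close>

text \<open>A cocycle on the vertices \<open>0, \<dots>, n\<close>. The condition with \<open>i = j = k\<close> forces \<open>E i i\<close> to be the
  unit, and then the one with \<open>k = i\<close> forces \<open>E j i\<close> to be the inverse of \<open>E i j\<close>.\<close>

definition cocycle :: "('a, 'z) partial_magma_scheme \<Rightarrow> nat \<Rightarrow> (nat \<Rightarrow> nat \<Rightarrow> 'a) \<Rightarrow> bool" where
  "cocycle P n E \<longleftrightarrow>
     (\<forall>i\<le>n. \<forall>j\<le>n. E i j \<in> carrier P) \<and>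
     (\<forall>i\<le>n. \<forall>j\<le>n. \<forall>k\<le>n. pmult P (E i j) (E j k) = Some (E i k))"

text \<open>The word of labels of the edges from each vertex to the next.\<close>

definition spine :: "nat \<Rightarrow> (nat \<Rightarrow> nat \<Rightarrow> 'a) \<Rightarrow> 'a list" where
  "spine n E = map (\<lambda>i. E i (Suc i)) [0..<n]"

lemma word_edge_closed:
  assumes P: "binary_partial_group P" and w: "w \<in> B_words P n"
  shows "word_edge P w i j \<in> carrier P"
  unfolding word_edge_def
  by (simp add: word_prod_closed[OF P B_words_factor[OF P w]] dagger_closed[OF P])

lemma word_edge_reverse:
  assumes P: "binary_partial_group P" and w: "w \<in> B_words P n"
  shows "word_edge P w j i = dagger P (word_edge P w i j)"
proof (rule linorder_cases[of i j])
  assume "j < i"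
  then have eq: "word_edge P w i j = dagger P (word_edge P w j i)"
    by (simp add: word_edge_def)
  show ?thesis
    unfolding eq by (rule dagger_dagger[OF P word_edge_closed[OF P w], symmetric])
qed (simp_all add: dagger_unit[OF P], simp add: word_edge_def)

lemma word_edge_pmult:
  assumes P: "binary_partial_group P" and w: "w \<in> B_words P n" and "i \<le> j" "j \<le> k"
  shows "pmult P (word_edge P w i j) (word_edge P w j k) = Some (word_edge P w i k)"
proof -
  have *: "take (k - i) (drop i w) = take (j - i) (drop i w) @ take (k - j) (drop j w)"
    using take_add[of "j - i" "k - j" "drop i w"] assms(3,4) by simp
  show ?thesis
    using word_prod_append[OF P, of "take (j - i) (drop i w)" "take (k - j) (drop j w)"]
      B_words_factor[OF P w, of "k - i" i] assms(3,4)
    unfolding word_edge_def * by simp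
qed

lemma cocycle_word_edge:
  assumes P: "binary_partial_group P" and w: "w \<in> B_words P n"
  shows "cocycle P n (word_edge P w)"
proof -
  let ?e = "word_edge P w"
  note cl = word_edge_closed[OF P w]
  have "pmult P (?e i j) (?e j k) = Some (?e i k)" for i j k
  proof -
    note reverse = word_edge_reverse[OF P w, symmetric]
    \<comment> \<open>In each order of the three vertices, the relation is a rotation or reflection of the one for
      the increasing order.\<close>
    consider "i \<le> j" "j \<le> k" | "i \<le> k" "k \<le> j" | "j \<le> i" "i \<le> k"
      | "j \<le> k" "k \<le> i" | "k \<le> i" "i \<le> j" | "k \<le> j" "j \<le> i" by linarith
    then show ?thesis
    proof cases
      case 1
      then show ?thesis by (rule word_edge_pmult[OF P w])
    next
      case 2
      then show ?thesis
        using pmult_dagger[OF P cl cl word_edge_pmult[OF P w 2]] by (simp only: reverse)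
    next
      case 3
      then show ?thesis
        using dagger_pmult[OF P cl cl word_edge_pmult[OF P w 3]] by (simp only: reverse)
    next
      case 4
      then show ?thesis
        using pmult_rotations(1)[OF P cl cl word_edge_pmult[OF P w 4]] by (simp only: reverse)
    next
      case 5
      then show ?thesis
        using pmult_rotations(2)[OF P cl cl word_edge_pmult[OF P w 5]] by (simp only: reverse)
    next
      case 6
      then show ?thesis
        using pmult_rotations(3)[OF P cl cl word_edge_pmult[OF P w 6]] by (simp only: reverse)
    qed
  qed
  then show ?thesis
    using cl by (simp add: cocycle_def)
qed

lemma spine_word_edge:
  assumes "w \<in> B_words P n"
  shows "spine n (word_edge P w) = w"
  using B_words_length[OF assms] by (intro nth_equalityI) (simp_all add: spine_def word_edge_Suc)

text \<open>The outermost product of a parenthesization splits the interval from \<open>i\<close> to \<open>j\<close> at some vertex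
  \<open>k\<close>, and the cocycle condition at \<open>i, k, j\<close> computes its value.\<close>

lemma evaluate_cocycle:
  assumes E: "cocycle P n E"
  shows "word t = map (\<lambda>i. E i (Suc i)) [i..<j] \<Longrightarrow> j \<le> n \<Longrightarrow> evaluate P t = Some (E i j)"
proof (induction t arbitrary: i j)
  case (Letter a)
  then have "length [i..<j] = 1"
    by (metis length_map length_Cons list.size(3) word.simps(1) One_nat_def)
  then have "j = Suc i" by simp
  with Letter show ?case by simp
next
  case (Times s t)
  let ?g = "\<lambda>i. E i (Suc i)"
  define k where "k = i + length (word s)"
  have eq: "word s @ word t = map ?g [i..<j]"
    using Times.prems by simp
  have "length (word s) + length (word t) = j - i"
    using arg_cong[OF eq, of length] by simp
  moreover have "0 < length (word t)" by simp
  ultimately have k: "i \<le> k" "k \<le> j"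
    unfolding k_def by linarith+
  then have "map ?g [i..<j] = map ?g [i..<k] @ map ?g [k..<j]"
    using upt_add_eq_append[of i k "j - k"] by simp
  with eq have "word s = map ?g [i..<k] \<and> word t = map ?g [k..<j]"
    by (simp add: append_eq_append_conv k_def)
  then have "evaluate P s = Some (E i k)" "evaluate P t = Some (E k j)"
    using Times.IH Times.prems(2) k by simp_all
  then show ?case
    using E k Times.prems(2) by (simp add: cocycle_def)
qed

lemma spine_in_B_words:
  assumes E: "cocycle P n E"
  shows "spine n E \<in> B_words P n"
  using evaluate_cocycle[OF E, of _ 0 n] E by (auto simp: B_words_def spine_def cocycle_def)

lemma word_edge_spine:
  assumes P: "binary_partial_group P" and E: "cocycle P n E" and i: "i \<le> n" and j: "j \<le> n"
  shows "word_edge P (spine n E) i j = E i j"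
proof -
  have diag: "E i i = unit P" if "i \<le> n" for i
    using idempotent_unit[OF P, of "E i i"] E that by (simp add: cocycle_def)
  have forward: "word_prod P (take (j - i) (drop i (spine n E))) = E i j" if "i \<le> j" "j \<le> n" for i j
  proof -
    have *: "take (j - i) (drop i (spine n E)) = map (\<lambda>i. E i (Suc i)) [i..<j]"
      using that by (simp add: spine_def take_map drop_map)
    show ?thesis
    proof (cases "i = j")
      case True
      then show ?thesis using diag that by simp
    next
      case False
      then show ?thesis
        unfolding * using that evaluate_cocycle[OF E] by (intro word_prod_eqI) auto
    qed
  qed
  show ?thesis
  proof (cases "i \<le> j")
    case True
    then show ?thesis using forward j by (simp add: word_edge_def)
  next
    case False
    have "E i j = dagger P (E j i)"
      using E i j diag[OF j] by (intro eq_dagger[OF P]) (auto simp: cocycle_def)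
    with False show ?thesis using forward[of j i] i by (simp add: word_edge_def)
  qed
qed

lemma cocycle_pullback:
  assumes "cocycle P n E" "\<alpha> \<in> ordmaps m n"
  shows "cocycle P m (\<lambda>i j. E (\<alpha> i) (\<alpha> j))"
proof -
  have "\<alpha> i \<le> n" if "i \<le> m" for i
    using assms(2) that by (auto simp: ordmaps_def)
  then show ?thesis
    using assms(1) by (simp add: cocycle_def)
qed

lemma cocycle_image:
  assumes "cocycle P n E" "f \<in> bpg_hom P Q"
  shows "cocycle Q n (\<lambda>i j. f (E i j))"
  using assms by (auto simp: cocycle_def bpg_hom_def)

section \<open>The symmetric set of a binary partial group\<close>

lemma simplices_B_obj: "simplices (B_obj P) = B_words P"
  by (simp add: B_obj_def)

lemma act_B_obj: "act (B_obj P) m n \<alpha> w = spine m (\<lambda>i j. word_edge P w (\<alpha> i) (\<alpha> j))"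
  by (simp add: B_obj_def spine_def)

lemma ordmaps_le: "\<alpha> \<in> ordmaps m n \<Longrightarrow> i \<le> m \<Longrightarrow> \<alpha> i \<le> n"
  by (auto simp: ordmaps_def)

lemma spine_cong:
  assumes "\<And>i. i < n \<Longrightarrow> E i (Suc i) = F i (Suc i)"
  shows "spine n E = spine n F"
  using assms by (simp add: spine_def)

lemma symmetric_set_B_obj:
  assumes P: "binary_partial_group P"
  shows "symmetric_set (B_obj P)"
  unfolding symmetric_set_def simplices_B_obj act_B_obj
proof (intro conjI allI ballI Pi_I)
  fix m n \<alpha> w assume "\<alpha> \<in> ordmaps m n" "w \<in> B_words P n"
  then show "spine m (\<lambda>i j. word_edge P w (\<alpha> i) (\<alpha> j)) \<in> B_words P m"
    using spine_in_B_words cocycle_pullback cocycle_word_edge[OF P] by blast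
next
  fix n w assume w: "w \<in> B_words P n"
  have "spine n (\<lambda>i j. word_edge P w (restrict id {..n} i) (restrict id {..n} j)) =
      spine n (word_edge P w)"
    by (rule spine_cong) simp
  then show "spine n (\<lambda>i j. word_edge P w (restrict id {..n} i) (restrict id {..n} j)) = w"
    using spine_word_edge[OF w] by simp
next
  fix l m n \<alpha> \<beta> w
  assume \<alpha>: "\<alpha> \<in> ordmaps l m" and \<beta>: "\<beta> \<in> ordmaps m n" and w: "w \<in> B_words P n"
  note E = cocycle_pullback[OF cocycle_word_edge[OF P w] \<beta>]
  show "spine l (\<lambda>i j. word_edge P w (compose {..l} \<beta> \<alpha> i) (compose {..l} \<beta> \<alpha> j)) =
      spine l (\<lambda>i j. word_edge P (spine m (\<lambda>i j. word_edge P w (\<beta> i) (\<beta> j))) (\<alpha> i) (\<alpha> j))"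
    using ordmaps_le[OF \<alpha>] by (intro spine_cong) (simp add: word_edge_spine[OF P E] compose_def)
qed

lemma edge_map_in_ordmaps: "i \<le> n \<Longrightarrow> j \<le> n \<Longrightarrow> edge_map i j \<in> ordmaps 1 n"
  by (auto simp: ordmaps_def edge_map_def)

lemma act_edge_map: "act (B_obj P) 1 n (edge_map i j) w = [word_edge P w i j]"
  by (simp add: act_B_obj spine_def edge_map_def)

lemma spiny_B_obj: "spiny (B_obj P)"
  unfolding spiny_def
proof (intro allI impI inj_onI)
  fix n v w
  assume v: "v \<in> simplices (B_obj P) n" and w: "w \<in> simplices (B_obj P) n"
    and eq: "segal (B_obj P) n v = segal (B_obj P) n w"
  have len: "length v = n" "length w = n"
    using v w by (simp_all add: simplices_B_obj B_words_length)
  have "v ! i = w ! i" if i: "i < n" for i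
  proof -
    have "Suc i \<in> set [1..<Suc n]"
      using i by (simp del: upt_Suc)
    then have "act (B_obj P) 1 n (edge_map (Suc i - 1) (Suc i)) v =
        act (B_obj P) 1 n (edge_map (Suc i - 1) (Suc i)) w"
      using eq unfolding segal_def map_eq_conv by blast
    then show ?thesis
      using i len unfolding act_edge_map by (simp add: word_edge_Suc)
  qed
  then show "v = w"
    using len by (simp add: nth_equalityI)
qed

lemma chermak_partial_group_B_obj:
  assumes "binary_partial_group P"
  shows "chermak_partial_group (B_obj P)"
  using symmetric_set_B_obj[OF assms] spiny_B_obj
  by (simp add: chermak_partial_group_def reduced_def simplices_B_obj B_words_0)

section \<open>Functoriality\<close>

lemma map_spine: "map f (spine n E) = spine n (\<lambda>i j. f (E i j))"
  by (simp add: spine_def)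

lemma map_eq_spine_word_edge:
  assumes "w \<in> B_words P n"
  shows "map f w = spine n (\<lambda>i j. f (word_edge P w i j))"
  using spine_word_edge[OF assms] by (metis map_spine)

lemma map_in_B_words:
  assumes "binary_partial_group P" "f \<in> bpg_hom P Q" "w \<in> B_words P n"
  shows "map f w \<in> B_words Q n"
  unfolding map_eq_spine_word_edge[OF assms(3)]
  using spine_in_B_words cocycle_image cocycle_word_edge assms by blast

lemma word_edge_map:
  assumes P: "binary_partial_group P" and Q: "binary_partial_group Q"
    and f: "f \<in> bpg_hom P Q" and w: "w \<in> B_words P n" and "i \<le> n" "j \<le> n"
  shows "word_edge Q (map f w) i j = f (word_edge P w i j)"
  unfolding map_eq_spine_word_edge[OF w]
  using word_edge_spine[OF Q cocycle_image[OF cocycle_word_edge[OF P w] f]] assms by simp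

lemma B_map_in_symset_hom:
  assumes P: "binary_partial_group P" and Q: "binary_partial_group Q" and f: "f \<in> bpg_hom P Q"
  shows "B_map P f \<in> symset_hom (B_obj P) (B_obj Q)"
  unfolding symset_hom_def simplices_B_obj mem_Collect_eq
proof (intro conjI allI ballI)
  fix n
  show "B_map P f n \<in> B_words P n \<rightarrow>\<^sub>E B_words Q n"
    using map_in_B_words[OF P f] by (auto simp: B_map_def)
next
  fix m n \<alpha> w assume \<alpha>: "\<alpha> \<in> ordmaps m n" and w: "w \<in> B_words P n"
  have "act (B_obj P) m n \<alpha> w \<in> B_words P m"
    using symmetric_set_B_obj[OF P] \<alpha> w by (auto simp: symmetric_set_def simplices_B_obj)
  then show "B_map P f m (act (B_obj P) m n \<alpha> w) = act (B_obj Q) m n \<alpha> (B_map P f n w)"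
    using w ordmaps_le[OF \<alpha>]
    by (auto simp: B_map_def act_B_obj map_spine word_edge_map[OF P Q f w] intro!: spine_cong)
qed

lemma B_map_id: "B_map P (restrict id (carrier P)) = symset_id (B_obj P)"
proof (intro ext)
  fix n w
  have "map (restrict id (carrier P)) w = w" if "w \<in> B_words P n"
    using B_words_carrier[OF that] by (intro map_idI) auto
  then show "B_map P (restrict id (carrier P)) n w = symset_id (B_obj P) n w"
    by (simp add: B_map_def symset_id_def simplices_B_obj restrict_def)
qed

lemma B_map_compose:
  assumes P: "binary_partial_group P" and f: "f \<in> bpg_hom P Q"
  shows "B_map P (compose (carrier P) g f) = symset_comp (B_obj P) (B_map Q g) (B_map P f)"
proof (intro ext)
  fix n w
  have "map (compose (carrier P) g f) w = map g (map f w)" if "w \<in> B_words P n"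
    using B_words_carrier[OF that] by (auto simp: compose_def)
  then show "B_map P (compose (carrier P) g f) n w = symset_comp (B_obj P) (B_map Q g) (B_map P f) n w"
    using map_in_B_words[OF P f] by (simp add: B_map_def symset_comp_def simplices_B_obj compose_def)
qed

section \<open>Full faithfulness\<close>

lemma inj_on_B_map: "inj_on (B_map P) (bpg_hom P Q)"
proof (rule inj_onI)
  fix f g assume f: "f \<in> bpg_hom P Q" and g: "g \<in> bpg_hom P Q" and eq: "B_map P f = B_map P g"
  have "f a = g a" if a: "a \<in> carrier P" for a
    using fun_cong[OF fun_cong[OF eq, of 1], of "[a]"] a
    by (simp add: B_map_def singleton_in_B_words del: One_nat_def)
  moreover have "f \<in> carrier P \<rightarrow>\<^sub>E carrier Q" "g \<in> carrier P \<rightarrow>\<^sub>E carrier Q"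
    using f g by (simp_all add: bpg_hom_def)
  ultimately show "f = g"
    by (metis PiE_ext)
qed

text \<open>The \<open>i\<close>-th letter of a word is an edge of the corresponding simplex, and symmetric maps commute
  with taking edges.\<close>

lemma symset_hom_letterwise:
  assumes \<phi>: "\<phi> \<in> symset_hom (B_obj P) (B_obj Q)" and w: "w \<in> B_words P n"
  shows "\<phi> n w = map (\<lambda>a. hd (\<phi> 1 [a])) w"
proof (rule nth_equalityI)
  have \<phi>w: "\<phi> n w \<in> B_words Q n"
    using \<phi> w by (auto simp: symset_hom_def simplices_B_obj)
  then show "length (\<phi> n w) = length (map (\<lambda>a. hd (\<phi> 1 [a])) w)"
    using w by (simp add: B_words_length)
  fix i assume "i < length (\<phi> n w)"
  then have i: "i < n"
    using \<phi>w by (simp add: B_words_length)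
  then have "edge_map i (Suc i) \<in> ordmaps 1 n"
    by (intro edge_map_in_ordmaps) auto
  then have "\<phi> 1 (act (B_obj P) 1 n (edge_map i (Suc i)) w) =
      act (B_obj Q) 1 n (edge_map i (Suc i)) (\<phi> n w)"
    using \<phi> w by (simp add: symset_hom_def simplices_B_obj)
  then have "\<phi> 1 [w ! i] = [\<phi> n w ! i]"
    using i B_words_length[OF w] B_words_length[OF \<phi>w] unfolding act_edge_map
    by (simp add: word_edge_Suc)
  then show "\<phi> n w ! i = map (\<lambda>a. hd (\<phi> 1 [a])) w ! i"
    using i B_words_length[OF w] by simp
qed

lemma word_edge_pair:
  assumes "pmult P a b = Some c"
  shows "word_edge P [a, b] 0 2 = c"
  using word_prod_pair[OF assms] by (simp add: word_edge_def)

lemma symset_hom_eq_B_map: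
  assumes \<phi>: "\<phi> \<in> symset_hom (B_obj P) (B_obj Q)" and P: "binary_partial_group P"
  shows "\<exists>f\<in>bpg_hom P Q. B_map P f = \<phi>"
proof
  define f where "f = (\<lambda>a\<in>carrier P. hd (\<phi> 1 [a]))"
  have \<phi>_ext: "\<phi> n \<in> B_words P n \<rightarrow>\<^sub>E B_words Q n" for n
    using \<phi> by (simp add: symset_hom_def simplices_B_obj)
  have \<phi>_map: "\<phi> n w = map f w" if "w \<in> B_words P n" for n w
  proof -
    have "map f w = map (\<lambda>a. hd (\<phi> 1 [a])) w"
      using B_words_carrier[OF that] unfolding f_def by (intro map_cong) auto
    then show ?thesis
      using symset_hom_letterwise[OF \<phi> that] by (rule trans[OF _ sym, rotated])
  qed
  have f_closed: "f a \<in> carrier Q" if "a \<in> carrier P" for a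
  proof -
    have a: "[a] \<in> B_words P 1"
      using that by (simp only: singleton_in_B_words)
    have "map f [a] \<in> B_words Q 1"
      using PiE_mem[OF \<phi>_ext a] unfolding \<phi>_map[OF a] .
    then show ?thesis
      by (simp only: list.map singleton_in_B_words)
  qed
  have f_mult: "pmult Q (f a) (f b) = Some (f c)"
    if a: "a \<in> carrier P" and b: "b \<in> carrier P" and c: "pmult P a b = Some c" for a b c
  proof -
    have ab: "[a, b] \<in> B_words P 2"
      using a b c by (simp add: pair_in_B_words)
    have "map f [a, b] \<in> B_words Q 2"
      using PiE_mem[OF \<phi>_ext ab] unfolding \<phi>_map[OF ab] .
    then obtain d where d: "pmult Q (f a) (f b) = Some d"
      by (auto simp: pair_in_B_words)
    \<comment> \<open>The edge from \<open>0\<close> to \<open>2\<close> of a two-letter word is the product of its letters.\<close>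
    have "\<phi> 1 (act (B_obj P) 1 2 (edge_map 0 2) [a, b]) = act (B_obj Q) 1 2 (edge_map 0 2) (\<phi> 2 [a, b])"
      using \<phi> ab edge_map_in_ordmaps[of 0 2 2] by (simp add: symset_hom_def simplices_B_obj)
    then have "\<phi> 1 [c] = [d]"
      using \<phi>_map[OF ab] word_edge_pair[OF c] word_edge_pair[OF d] unfolding act_edge_map by simp
    moreover have "[c] \<in> B_words P 1"
      using pmult_closed[OF P a b c] by (simp only: singleton_in_B_words)
    ultimately show ?thesis
      using \<phi>_map[of "[c]" 1] d by simp
  qed
  show "f \<in> bpg_hom P Q"
    using f_closed f_mult by (auto simp: bpg_hom_def f_def)
  show "B_map P f = \<phi>"
  proof (intro ext)
    fix n w
    show "B_map P f n w = \<phi> n w"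
      using \<phi>_map[of w n] PiE_arb[OF \<phi>_ext, of w n] by (auto simp: B_map_def)
  qed
qed

theorem corollary11:
  fixes P :: "'a partial_magma" and Q :: "'b partial_magma" and R :: "'c partial_magma"
  assumes "binary_partial_group P" and "binary_partial_group Q" and "binary_partial_group R"
  shows "(chermak_partial_group (B_obj P) \<and>
          (\<forall>f\<in>bpg_hom P Q. B_map P f \<in> symset_hom (B_obj P) (B_obj Q)) \<and>
          B_map P (restrict id (carrier P)) = symset_id (B_obj P) \<and>
          (\<forall>f\<in>bpg_hom P Q. \<forall>g\<in>bpg_hom Q R.
             B_map P (compose (carrier P) g f) = symset_comp (B_obj P) (B_map Q g) (B_map P f))) \<and>
         bij_betw (B_map P) (bpg_hom P Q) (symset_hom (B_obj P) (B_obj Q))"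
proof (intro conjI ballI)
  show "chermak_partial_group (B_obj P)"
    using chermak_partial_group_B_obj assms(1) .
  show B_hom: "B_map P f \<in> symset_hom (B_obj P) (B_obj Q)" if "f \<in> bpg_hom P Q" for f
    using B_map_in_symset_hom assms(1,2) that .
  show "B_map P (restrict id (carrier P)) = symset_id (B_obj P)"
    by (rule B_map_id)
  show "B_map P (compose (carrier P) g f) = symset_comp (B_obj P) (B_map Q g) (B_map P f)"
    if "f \<in> bpg_hom P Q" "g \<in> bpg_hom Q R" for f g
    using B_map_compose assms(1) that(1) .
  have "B_map P ` bpg_hom P Q = symset_hom (B_obj P) (B_obj Q)"
    using B_hom symset_hom_eq_B_map[OF _ assms(1)] by (fastforce simp: image_iff)
  then show "bij_betw (B_map P) (bpg_hom P Q) (symset_hom (B_obj P) (B_obj Q))"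
    using inj_on_B_map by (simp add: bij_betw_def)
qed

end
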